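(* The category $\mathbf{OrdMon}^{*}$ is isomorphic to the category $\mathbf{RNMono}(\mathbf{Mon})$ of right normal monomorphisms in the category $\mathbf{Mon}$ of monoids.
   Context: Monoids are written additively but are not assumed commutative. A preordered monoid $(A,+,0,\leq)$ is a monoid $(A,+,0)$ with a preorder $\leq$ such that $a\leq b$ and $c\leq d$ imply $a+c\leq b+d$. $\mathbf{OrdMon}$ is the category of preordered monoids and monotone monoid homomorphisms. The positive cone of $(A,+,0,\leq)$ is the submonoid $P=\{a\in A\mid 0\leq a\}$, and $\leq_P$ is the relation on $A$ given by $a\leq_P b$ if and only if $b\in P+a=\{x+a\mid x\in P\}$. $\mathbf{OrdMon}^{*}$ is the full subcategory of $\mathbf{OrdMon}$ whose objects are the preordered monoids for which $\leq$ coincides with $\leq_P$. A submonoid $M$ of a monoid $A$ is right normal if $a+M\subseteq M+a$ for every $a\in A$. A monomorphism of monoids $m\colon S\to A$ is right normal if $m(S)$ is a right normal submonoid of $A$. $\mathbf{RNMono}(\mathbf{Mon})$ is the category of right normal monomorphisms, where monomorphisms are taken to be inclusions of submonoids: objects are inclusions $S\to A$ of a right normal submonoid $S$ of a monoid $A$; a morphism from $S\to A$ to $S'\to A'$ is a commutative square, i.e. a pair of monoid homomorphisms $f'\colon S\to S'$ and $f\colon A\to A'$ such that $f'$ is the restriction of $f$ (equivalently, a homomorphism $f\colon A\to A'$ with $f(S)\subseteq S'$). *)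

theory Defs
  imports "HOL-Algebra.Coset"
begin

section \<open>Categories\<close>

record ('o, 'm) category =
  Ob   :: "'o set"
  Mor  :: "'m set"
  Dom  :: "'m \<Rightarrow> 'o"
  Cod  :: "'m \<Rightarrow> 'o"
  Id   :: "'o \<Rightarrow> 'm"
  Comp :: "'m \<Rightarrow> 'm \<Rightarrow> 'm"  \<comment> \<open>\<open>Comp C g f\<close> is \<open>g\<close> after \<open>f\<close>\<close>

locale category =
  fixes C :: "('o, 'm) category"
  assumes Dom_in_Ob: "f \<in> Mor C \<Longrightarrow> Dom C f \<in> Ob C"
    and Cod_in_Ob: "f \<in> Mor C \<Longrightarrow> Cod C f \<in> Ob C"
    and Id_in_Mor: "X \<in> Ob C \<Longrightarrow> Id C X \<in> Mor C"
    and Dom_Id: "X \<in> Ob C \<Longrightarrow> Dom C (Id C X) = X"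
    and Cod_Id: "X \<in> Ob C \<Longrightarrow> Cod C (Id C X) = X"
    and Comp_in_Mor:
      "\<lbrakk>f \<in> Mor C; g \<in> Mor C; Cod C f = Dom C g\<rbrakk> \<Longrightarrow> Comp C g f \<in> Mor C"
    and Dom_Comp:
      "\<lbrakk>f \<in> Mor C; g \<in> Mor C; Cod C f = Dom C g\<rbrakk> \<Longrightarrow> Dom C (Comp C g f) = Dom C f"
    and Cod_Comp:
      "\<lbrakk>f \<in> Mor C; g \<in> Mor C; Cod C f = Dom C g\<rbrakk> \<Longrightarrow> Cod C (Comp C g f) = Cod C g"
    and Comp_Id_right: "f \<in> Mor C \<Longrightarrow> Comp C f (Id C (Dom C f)) = f"
    and Comp_Id_left: "f \<in> Mor C \<Longrightarrow> Comp C (Id C (Cod C f)) f = f"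
    and Comp_assoc:
      "\<lbrakk>f \<in> Mor C; g \<in> Mor C; h \<in> Mor C; Cod C f = Dom C g; Cod C g = Dom C h\<rbrakk>
       \<Longrightarrow> Comp C h (Comp C g f) = Comp C (Comp C h g) f"

locale cat_functor = C: category C + D: category D
  for C :: "('o, 'm) category" and D :: "('p, 'n) category" +
  fixes Fo :: "'o \<Rightarrow> 'p" and Fm :: "'m \<Rightarrow> 'n"
  assumes Fo_in_Ob: "X \<in> Ob C \<Longrightarrow> Fo X \<in> Ob D"
    and Fm_in_Mor: "f \<in> Mor C \<Longrightarrow> Fm f \<in> Mor D"
    and Dom_Fm: "f \<in> Mor C \<Longrightarrow> Dom D (Fm f) = Fo (Dom C f)"
    and Cod_Fm: "f \<in> Mor C \<Longrightarrow> Cod D (Fm f) = Fo (Cod C f)"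
    and Fm_Id: "X \<in> Ob C \<Longrightarrow> Fm (Id C X) = Id D (Fo X)"
    and Fm_Comp:
      "\<lbrakk>f \<in> Mor C; g \<in> Mor C; Cod C f = Dom C g\<rbrakk>
       \<Longrightarrow> Fm (Comp C g f) = Comp D (Fm g) (Fm f)"

text \<open>Isomorphism, not merely equivalence: the two functors are strictly inverse to each other.\<close>

definition isomorphic_categories ::
    "('o, 'm) category \<Rightarrow> ('p, 'n) category \<Rightarrow> bool" where
  "isomorphic_categories C D \<longleftrightarrow>
     (\<exists>Fo Fm Go Gm. cat_functor C D Fo Fm \<and> cat_functor D C Go Gm \<and>
        (\<forall>X\<in>Ob C. Go (Fo X) = X) \<and> (\<forall>f\<in>Mor C. Gm (Fm f) = f) \<and>
        (\<forall>Y\<in>Ob D. Fo (Go Y) = Y) \<and> (\<forall>g\<in>Mor D. Fm (Gm g) = g))"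

definition full_subcategory :: "('o, 'm) category \<Rightarrow> 'o set \<Rightarrow> ('o, 'm) category" where
  "full_subcategory C S =
     C\<lparr>Ob := Ob C \<inter> S, Mor := {f \<in> Mor C. Dom C f \<in> S \<and> Cod C f \<in> S}\<rparr>"

definition monomorphism :: "('o, 'm) category \<Rightarrow> 'm \<Rightarrow> bool" where
  "monomorphism C m \<longleftrightarrow> m \<in> Mor C \<and>
     (\<forall>f\<in>Mor C. \<forall>g\<in>Mor C. Dom C f = Dom C g \<and> Cod C f = Dom C m \<and> Cod C g = Dom C m \<and>
        Comp C m f = Comp C m g \<longrightarrow> f = g)"

text \<open>A morphism is tagged with its source and target, so that hom-sets are disjoint.\<close>

datatype ('o, 'f) arr = Arr (src: 'o) (the_map: 'f) (tgt: 'o)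

text \<open>
  The category of arrows and commutative squares: a morphism \<open>Arr m (u, v) n\<close> is the square
  with \<open>u\<close> between the domains, \<open>v\<close> between the codomains, and \<open>n \<circ> u = v \<circ> m\<close>.
\<close>

definition arrow_category ::
    "('o, 'm) category \<Rightarrow> ('m, ('m, 'm \<times> 'm) arr) category" where
  "arrow_category C =
     \<lparr>Ob = Mor C,
      Mor = {Arr m (u, v) n | m u v n.
               m \<in> Mor C \<and> n \<in> Mor C \<and> u \<in> Mor C \<and> v \<in> Mor C \<and>
               Dom C u = Dom C m \<and> Cod C u = Dom C n \<and>
               Dom C v = Cod C m \<and> Cod C v = Cod C n \<and>
               Comp C n u = Comp C v m},
      Dom = src,
      Cod = tgt,
      Id = (\<lambda>m. Arr m (Id C (Dom C m), Id C (Cod C m)) m),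
      Comp = (\<lambda>q p. Arr (src p)
                (Comp C (fst (the_map q)) (fst (the_map p)),
                 Comp C (snd (the_map q)) (snd (the_map p)))
                (tgt q))\<rparr>"


section \<open>Monoids and preordered monoids\<close>

text \<open>
  The type \<open>'a\<close> plays the role of the universe: a monoid is a monoid structure on a subset of it.
  The (not necessarily commutative) operation is written multiplicatively, as in HOL-Algebra.
  Since HOL functions are total, operations and homomorphisms are required to be \<open>undefined\<close>
  off the carrier; otherwise one monoid would be represented by several different objects, and
  one homomorphism by several different morphisms.
\<close>

locale canonical_monoid = monoid +
  assumes mult_outside:
    "x \<notin> carrier G \<or> y \<notin> carrier G \<Longrightarrow> x \<otimes>\<^bsub>G\<^esub> y = undefined"

definition monoid_hom ::
    "('a, 'c) monoid_scheme \<Rightarrow> ('b, 'd) monoid_scheme \<Rightarrow> ('a \<Rightarrow> 'b) set" where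
  "monoid_hom A B =
     {f \<in> hom A B. f \<one>\<^bsub>A\<^esub> = \<one>\<^bsub>B\<^esub>} \<inter> extensional (carrier A)"

definition concrete_category ::
    "('a, 'c) monoid_scheme set
     \<Rightarrow> (('a, 'c) monoid_scheme \<Rightarrow> ('a, 'c) monoid_scheme \<Rightarrow> ('a \<Rightarrow> 'a) set)
     \<Rightarrow> (('a, 'c) monoid_scheme, (('a, 'c) monoid_scheme, 'a \<Rightarrow> 'a) arr) category" where
  "concrete_category Obs Hom =
     \<lparr>Ob = Obs,
      Mor = {Arr A f B | A f B. A \<in> Obs \<and> B \<in> Obs \<and> f \<in> Hom A B},
      Dom = src,
      Cod = tgt,
      Id = (\<lambda>A. Arr A (\<lambda>x\<in>carrier A. x) A),
      Comp = (\<lambda>g f. Arr (src f) (compose (carrier (src f)) (the_map g) (the_map f)) (tgt g))\<rparr>"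

definition Mon :: "('a monoid, ('a monoid, 'a \<Rightarrow> 'a) arr) category" where
  "Mon = concrete_category {A. canonical_monoid A} monoid_hom"

record 'a preordered_monoid = "'a monoid" +
  leq :: "('a \<times> 'a) set"

locale preordered_monoid = canonical_monoid A
  for A :: "'a preordered_monoid" +
  assumes preorder: "preorder_on (carrier A) (leq A)"
    and mult_leq_mono:
      "\<lbrakk>(a, b) \<in> leq A; (c, d) \<in> leq A\<rbrakk> \<Longrightarrow> (a \<otimes>\<^bsub>A\<^esub> c, b \<otimes>\<^bsub>A\<^esub> d) \<in> leq A"

definition monotone_hom ::
    "'a preordered_monoid \<Rightarrow> 'b preordered_monoid \<Rightarrow> ('a \<Rightarrow> 'b) set" where
  "monotone_hom A B = {f \<in> monoid_hom A B. \<forall>(a, b) \<in> leq A. (f a, f b) \<in> leq B}"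

definition OrdMon ::
    "('a preordered_monoid, ('a preordered_monoid, 'a \<Rightarrow> 'a) arr) category" where
  "OrdMon = concrete_category {A. preordered_monoid A} monotone_hom"

definition positive_cone :: "'a preordered_monoid \<Rightarrow> 'a set" where
  "positive_cone A = {a \<in> carrier A. (\<one>\<^bsub>A\<^esub>, a) \<in> leq A}"

definition leq_of :: "('a, 'c) monoid_scheme \<Rightarrow> 'a set \<Rightarrow> ('a \<times> 'a) set" where
  "leq_of A P = {(a, b). a \<in> carrier A \<and> b \<in> carrier A \<and> b \<in> P #>\<^bsub>A\<^esub> a}"

definition OrdMon_star ::
    "('a preordered_monoid, ('a preordered_monoid, 'a \<Rightarrow> 'a) arr) category" where
  "OrdMon_star = full_subcategory OrdMon {A. leq A = leq_of A (positive_cone A)}"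


section \<open>Right normal monomorphisms\<close>

locale right_normal_submonoid = submonoid +
  assumes right_normal: "a \<in> carrier G \<Longrightarrow> a <#\<^bsub>G\<^esub> H \<subseteq> H #>\<^bsub>G\<^esub> a"

definition right_normal_mono :: "('a monoid, 'a \<Rightarrow> 'a) arr \<Rightarrow> bool" where
  "right_normal_mono m \<longleftrightarrow>
     monomorphism Mon m \<and> right_normal_submonoid (the_map m ` carrier (src m)) (tgt m)"

definition submonoid_structure :: "'a monoid \<Rightarrow> 'a set \<Rightarrow> 'a monoid" where
  "submonoid_structure A S =
     A\<lparr>carrier := S,
       mult := (\<lambda>x y. if x \<in> S \<and> y \<in> S then x \<otimes>\<^bsub>A\<^esub> y else undefined)\<rparr>"

definition submonoid_inclusion :: "'a monoid \<Rightarrow> 'a set \<Rightarrow> ('a monoid, 'a \<Rightarrow> 'a) arr" where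
  "submonoid_inclusion A S = Arr (submonoid_structure A S) (\<lambda>x\<in>S. x) A"

definition RNMono_Mon ::
    "(('a monoid, 'a \<Rightarrow> 'a) arr,
      (('a monoid, 'a \<Rightarrow> 'a) arr,
       ('a monoid, 'a \<Rightarrow> 'a) arr \<times> ('a monoid, 'a \<Rightarrow> 'a) arr) arr) category" where
  "RNMono_Mon = full_subcategory (arrow_category Mon)
     {m. right_normal_mono m \<and>
         (\<exists>A S. canonical_monoid A \<and> submonoid S A \<and> m = submonoid_inclusion A S)}"

end

theory Submission
  imports Defs
begin

text \<open>
  In an object of \<open>OrdMon_star\<close> the order is determined by the positive cone \<open>P\<close>, and \<open>P\<close> is right
  normal because \<open>a = a \<otimes> \<one> \<le> a \<otimes> x\<close> for \<open>x \<in> P\<close>. Conversely, right normality of a submonoid \<open>S\<close>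
  is what makes multiplication monotone for \<open>leq_of A S\<close>: from \<open>b = x \<otimes> a\<close> and \<open>d = y \<otimes> c\<close> one gets
  \<open>b \<otimes> d = x \<otimes> (a \<otimes> y) \<otimes> c = x \<otimes> y' \<otimes> (a \<otimes> c)\<close> for some \<open>y' \<in> S\<close>; and the positive cone of
  \<open>leq_of A S\<close> is \<open>S\<close> again. Hence objects and morphisms of both categories are described by the
  same data, namely right normal submonoids and homomorphisms that map one into the other.
\<close>

section \<open>Constructions of categories\<close>

lemma category_full_subcategory:
  assumes "category C"
  shows "category (full_subcategory C S)"
proof -
  interpret category C by fact
  show ?thesis
    by unfold_locales
      (auto simp: full_subcategory_def Dom_in_Ob Cod_in_Ob Id_in_Mor Dom_Id Cod_Id Comp_in_Mor
        Dom_Comp Cod_Comp Comp_Id_left Comp_Id_right Comp_assoc)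
qed

lemma Arr_in_Mor_arrow_category:
  "Arr m (u, v) n \<in> Mor (arrow_category C) \<longleftrightarrow>
     m \<in> Mor C \<and> n \<in> Mor C \<and> u \<in> Mor C \<and> v \<in> Mor C \<and>
     Dom C u = Dom C m \<and> Cod C u = Dom C n \<and> Dom C v = Cod C m \<and> Cod C v = Cod C n \<and>
     Comp C n u = Comp C v m"
  by (simp add: arrow_category_def)

lemma category_arrow_category:
  assumes "category C"
  shows "category (arrow_category C)"
proof -
  interpret category C by fact
  \<comment> \<open>Pasting of two commuting squares: \<open>p u' u = v' n u = v' v m\<close>, using
    first the right square and then the left one.\<close>
  have square_comp: "Comp C p (Comp C u' u) = Comp C (Comp C v' v) m"
    if "m \<in> Mor C" "n \<in> Mor C" "p \<in> Mor C" "u \<in> Mor C" "v \<in> Mor C" "u' \<in> Mor C" "v' \<in> Mor C"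
      "Dom C u = Dom C m" "Cod C u = Dom C n" "Dom C v = Cod C m" "Cod C v = Cod C n"
      "Dom C u' = Dom C n" "Cod C u' = Dom C p" "Dom C v' = Cod C n" "Cod C v' = Cod C p"
      "Comp C n u = Comp C v m" "Comp C p u' = Comp C v' n"
    for m n p u v u' v'
    using that by (metis Comp_assoc)
  \<comment> \<open>The objects are variables because the identities attached to a square sit at
    \<open>Dom C m\<close> or \<open>Cod C m\<close>, which equal \<open>Dom C u\<close> only
    through the equations of the square.\<close>
  have id_right: "Comp C u (Id C X) = u" and id_left: "Comp C (Id C Y) u = u"
    if "u \<in> Mor C" "Dom C u = X" "Cod C u = Y" for u X Y
    using that Comp_Id_right Comp_Id_left by auto
  show ?thesis
    by unfold_locales
      (auto simp: arrow_category_def Dom_in_Ob Cod_in_Ob Id_in_Mor Dom_Id Cod_Id Comp_in_Mor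
        Dom_Comp Cod_Comp Comp_Id_left Comp_Id_right Comp_assoc intro: square_comp id_right id_left)
qed

text \<open>Composing with the restricted identity resets all values outside the carrier to
  \<open>undefined\<close>, so the identity laws rest on morphisms being extensional.\<close>

lemma category_concrete_category:
  assumes extensional: "\<And>A B f. \<lbrakk>A \<in> Obs; B \<in> Obs; f \<in> Hom A B\<rbrakk> \<Longrightarrow> f \<in> carrier A \<rightarrow>\<^sub>E carrier B"
    and identity: "\<And>A. A \<in> Obs \<Longrightarrow> (\<lambda>x\<in>carrier A. x) \<in> Hom A A"
    and composition: "\<And>A B C f g. \<lbrakk>A \<in> Obs; B \<in> Obs; C \<in> Obs; f \<in> Hom A B; g \<in> Hom B C\<rbrakk>
      \<Longrightarrow> compose (carrier A) g f \<in> Hom A C"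
  shows "category (concrete_category Obs Hom)"
proof
  fix f
  assume "f \<in> Mor (concrete_category Obs Hom)"
  then obtain A g B where f: "f = Arr A g B" "A \<in> Obs" "B \<in> Obs" "g \<in> Hom A B"
    by (auto simp: concrete_category_def)
  note g = extensional[OF f(2-4)]
  let ?C = "concrete_category Obs Hom"
  show "Comp ?C f (Id ?C (Dom ?C f)) = f"
    using g by (auto simp: f(1) concrete_category_def compose_def PiE_def extensional_def fun_eq_iff)
  show "Comp ?C (Id ?C (Cod ?C f)) f = f"
    using g by (auto simp: f(1) concrete_category_def compose_def PiE_def extensional_def Pi_def fun_eq_iff)
next
  fix f g h
  let ?C = "concrete_category Obs Hom"
  assume *: "f \<in> Mor ?C" "g \<in> Mor ?C" "h \<in> Mor ?C" "Cod ?C f = Dom ?C g" "Cod ?C g = Dom ?C h"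
  \<comment> \<open>The composite of \<open>g\<close> and \<open>h\<close> is
    \<open>undefined\<close> off the carrier of \<open>src g\<close>; associativity holds because
    \<open>f\<close> takes its values in that carrier.\<close>
  then have "the_map f \<in> carrier (src f) \<rightarrow> carrier (src g)"
    using extensional by (fastforce simp: concrete_category_def)
  then show "Comp ?C h (Comp ?C g f) = Comp ?C (Comp ?C h g) f"
    by (auto simp: concrete_category_def compose_def fun_eq_iff)
qed (auto simp: concrete_category_def identity composition)

section \<open>Monoids, preordered monoids and right normal submonoids\<close>

lemma monoid_hom_PiE: "f \<in> monoid_hom A B \<Longrightarrow> f \<in> carrier A \<rightarrow>\<^sub>E carrier B"
  by (auto simp: monoid_hom_def hom_def PiE_def)

lemma restrict_id_monoid_hom:
  assumes "monoid A"
  shows "(\<lambda>x\<in>carrier A. x) \<in> monoid_hom A A"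
proof -
  interpret monoid A by fact
  show ?thesis by (auto simp: monoid_hom_def hom_def)
qed

lemma compose_monoid_hom:
  assumes "monoid A" "f \<in> monoid_hom A B" "g \<in> monoid_hom B C"
  shows "compose (carrier A) g f \<in> monoid_hom A C"
proof -
  interpret monoid A by fact
  show ?thesis using assms(2,3) by (auto simp: monoid_hom_def hom_def compose_def Pi_def)
qed

lemma category_Mon: "category Mon"
  unfolding Mon_def
  by (rule category_concrete_category)
    (auto simp: canonical_monoid_def dest: monoid_hom_PiE
      intro: restrict_id_monoid_hom compose_monoid_hom)

text \<open>\<open>monotone_hom\<close> quantifies over related pairs, while restricted identities
  and composites are controlled only on the carrier; this inclusion bridges the two.\<close>

lemma leq_subset_carrier:
  assumes "preordered_monoid A"
  shows "leq A \<subseteq> carrier A \<times> carrier A"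
  using preordered_monoid.preorder[OF assms] by (auto simp: preorder_on_def refl_on_def)

lemma category_OrdMon: "category OrdMon"
  unfolding OrdMon_def
proof (rule category_concrete_category)
  fix A :: "'a preordered_monoid"
  assume "A \<in> {A. preordered_monoid A}"
  then interpret preordered_monoid A by simp
  show "(\<lambda>x\<in>carrier A. x) \<in> monotone_hom A A"
    using leq_subset_carrier[OF preordered_monoid_axioms] restrict_id_monoid_hom[OF monoid_axioms]
    by (auto simp: monotone_hom_def)
next
  fix A B C :: "'a preordered_monoid" and f g
  assume A: "A \<in> {A. preordered_monoid A}" and fg: "f \<in> monotone_hom A B" "g \<in> monotone_hom B C"
  interpret preordered_monoid A using A by simp
  have "compose (carrier A) g f \<in> monoid_hom A C"
    using fg by (auto simp: monotone_hom_def intro: compose_monoid_hom monoid_axioms)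
  then show "compose (carrier A) g f \<in> monotone_hom A C"
    using fg leq_subset_carrier[OF preordered_monoid_axioms]
    by (fastforce simp: monotone_hom_def compose_def)
qed (auto simp: monotone_hom_def dest: monoid_hom_PiE)

section \<open>Preordered monoids versus monoids with a distinguished submonoid\<close>

definition underlying_monoid :: "'a preordered_monoid \<Rightarrow> 'a monoid" where
  "underlying_monoid A = \<lparr>carrier = carrier A, mult = mult A, one = one A\<rparr>"

definition cone_preordered :: "'a monoid \<Rightarrow> 'a set \<Rightarrow> 'a preordered_monoid" where
  "cone_preordered A S = \<lparr>carrier = carrier A, mult = mult A, one = one A, leq = leq_of A S\<rparr>"

lemma cone_preordered_simps [simp]:
  "carrier (cone_preordered A S) = carrier A"
  "mult (cone_preordered A S) = mult A"
  "one (cone_preordered A S) = one A"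
  "leq (cone_preordered A S) = leq_of A S"
  by (simp_all add: cone_preordered_def)

lemma underlying_cone_preordered [simp]: "underlying_monoid (cone_preordered A S) = A"
  by (simp add: underlying_monoid_def)

lemma monoid_hom_cone_preordered [simp]:
  "monoid_hom (cone_preordered A S) (cone_preordered B T) = monoid_hom A B"
  by (simp add: monoid_hom_def hom_def)

lemma leq_of_cone_preordered [simp]: "leq_of (cone_preordered A S) P = leq_of A P"
  by (simp add: leq_of_def r_coset_def)

text \<open>The common data to which the objects of both categories are reduced.\<close>

locale right_normal_pair = canonical_monoid A + right_normal_submonoid S A
  for A :: "'a monoid" and S
begin

text \<open>The carrier condition on \<open>b\<close> is absorbed: \<open>S\<close> lies in the
  carrier, so \<open>x \<otimes> a\<close> does too.\<close>

lemma leq_of_iff: "(a, b) \<in> leq_of A S \<longleftrightarrow> a \<in> carrier A \<and> (\<exists>x\<in>S. b = x \<otimes>\<^bsub>A\<^esub> a)"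
  using subset by (auto simp: leq_of_def r_coset_def)

text \<open>An element is positive iff it has the form \<open>x \<otimes> \<one>\<close> with
  \<open>x \<in> S\<close>, that is, iff it lies in \<open>S\<close>.\<close>

lemma positive_cone_cone_preordered [simp]: "positive_cone (cone_preordered A S) = S"
  using subset by (auto simp: positive_cone_def leq_of_iff subset_iff)

text \<open>Reflexivity comes from \<open>\<one> \<in> S\<close>, transitivity from closure of
  \<open>S\<close> under multiplication, and compatibility with the operation from right
  normality.\<close>

lemma preordered_monoid_cone_preordered: "preordered_monoid (cone_preordered A S)"
proof
  show "preorder_on (carrier (cone_preordered A S)) (leq (cone_preordered A S))"
    unfolding preorder_on_def refl_on_def trans_def
  proof (intro conjI allI impI ballI)
    fix x assume "x \<in> carrier (cone_preordered A S)"
    then show "(x, x) \<in> leq (cone_preordered A S)"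
      by (auto simp: leq_of_iff intro: bexI[of _ "\<one>\<^bsub>A\<^esub>"])
  next
    fix x y z
    assume "(x, y) \<in> leq (cone_preordered A S)" "(y, z) \<in> leq (cone_preordered A S)"
    then obtain s t where "x \<in> carrier A" "s \<in> S" "t \<in> S" "z = t \<otimes>\<^bsub>A\<^esub> (s \<otimes>\<^bsub>A\<^esub> x)"
      by (auto simp: leq_of_iff)
    then show "(x, z) \<in> leq (cone_preordered A S)"
      by (auto simp: leq_of_iff m_assoc intro!: bexI[of _ "t \<otimes>\<^bsub>A\<^esub> s"])
  qed (auto simp: leq_of_def)
next
  fix a b c d
  assume "(a, b) \<in> leq (cone_preordered A S)" "(c, d) \<in> leq (cone_preordered A S)"
  then obtain x y where xy: "a \<in> carrier A" "c \<in> carrier A" "x \<in> S" "y \<in> S"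
      "b = x \<otimes>\<^bsub>A\<^esub> a" "d = y \<otimes>\<^bsub>A\<^esub> c"
    by (auto simp: leq_of_iff)
  \<comment> \<open>Right normality carries \<open>y\<close> across \<open>a\<close>, at the price
    of replacing it by another element of \<open>S\<close>.\<close>
  then obtain z where z: "z \<in> S" "a \<otimes>\<^bsub>A\<^esub> y = z \<otimes>\<^bsub>A\<^esub> a"
    using right_normal[of a] by (auto simp: l_coset_def r_coset_def)
  have "b \<otimes>\<^bsub>A\<^esub> d = x \<otimes>\<^bsub>A\<^esub> (a \<otimes>\<^bsub>A\<^esub> y) \<otimes>\<^bsub>A\<^esub> c"
    using xy by (simp add: m_assoc)
  also have "\<dots> = (x \<otimes>\<^bsub>A\<^esub> z) \<otimes>\<^bsub>A\<^esub> (a \<otimes>\<^bsub>A\<^esub> c)"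
    using xy(1-4) z by (simp add: m_assoc)
  finally show "(a \<otimes>\<^bsub>cone_preordered A S\<^esub> c, b \<otimes>\<^bsub>cone_preordered A S\<^esub> d)
      \<in> leq (cone_preordered A S)"
    using xy z(1) by (auto simp: leq_of_iff)
qed (auto simp: m_assoc mult_outside)

lemma canonical_monoid_submonoid_structure: "canonical_monoid (submonoid_structure A S)"
  by unfold_locales (auto simp: submonoid_structure_def m_assoc)

end

text \<open>The cone is closed under multiplication because
  \<open>\<one> = \<one> \<otimes> \<one> \<le> x \<otimes> y\<close> for positive \<open>x\<close>
  and \<open>y\<close>.\<close>

lemma right_normal_pair_positive_cone:
  assumes "preordered_monoid A" "leq A = leq_of A (positive_cone A)"
  shows "right_normal_pair (underlying_monoid A) (positive_cone A)"
proof -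
  interpret preordered_monoid A by fact
  have refl: "(a, a) \<in> leq A" if "a \<in> carrier A" for a
    using preorder that by (auto simp: preorder_on_def refl_on_def)
  show ?thesis
  proof
    fix x y
    assume "x \<in> positive_cone A" "y \<in> positive_cone A"
    then show "x \<otimes>\<^bsub>underlying_monoid A\<^esub> y \<in> positive_cone A"
      using mult_leq_mono[of "\<one>\<^bsub>A\<^esub>" x "\<one>\<^bsub>A\<^esub>" y]
      by (auto simp: positive_cone_def underlying_monoid_def)
  next
    fix a
    assume "a \<in> carrier (underlying_monoid A)"
    then have a: "a \<in> carrier A" by (simp add: underlying_monoid_def)
    have "a \<otimes>\<^bsub>A\<^esub> x \<in> positive_cone A #>\<^bsub>A\<^esub> a" if "x \<in> positive_cone A" for x
    proof -
      have "(a, a \<otimes>\<^bsub>A\<^esub> x) \<in> leq A"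
        using mult_leq_mono[OF refl[OF a], of "\<one>\<^bsub>A\<^esub>" x] a that by (simp add: positive_cone_def)
      \<comment> \<open>Coincidence of the two orders turns the inequality into membership of
        \<open>a \<otimes> x\<close> in the right coset of \<open>a\<close>.\<close>
      then show ?thesis using assms(2) by (simp add: leq_of_def)
    qed
    then show "a <#\<^bsub>underlying_monoid A\<^esub> positive_cone A
        \<subseteq> positive_cone A #>\<^bsub>underlying_monoid A\<^esub> a"
      by (auto simp: underlying_monoid_def l_coset_def r_coset_def)
  qed (auto simp: underlying_monoid_def positive_cone_def m_assoc mult_outside refl)
qed

text \<open>The monoid fields are only copied, and the hypothesis says exactly that the order is
  rebuilt from the cone.\<close>

lemma cone_preordered_positive_cone:
  assumes "leq A = leq_of A (positive_cone A)"
  shows "cone_preordered (underlying_monoid A) (positive_cone A) = A"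
  using assms
  by (cases A) (simp add: cone_preordered_def underlying_monoid_def leq_of_def r_coset_def)

text \<open>Elements \<open>x\<close> of \<open>S\<close> are those with
  \<open>\<one> \<le> x\<close>, and a homomorphism fixes \<open>\<one>\<close>, so monotonicity
  sends \<open>S\<close> into \<open>T\<close>. Conversely, \<open>b = x \<otimes> a\<close> yields
  \<open>f b = f x \<otimes> f a\<close> with \<open>f x \<in> T\<close>.\<close>

lemma monotone_hom_cone_preordered:
  assumes "right_normal_pair A S" "right_normal_pair B T"
  shows "f \<in> monotone_hom (cone_preordered A S) (cone_preordered B T)
    \<longleftrightarrow> f \<in> monoid_hom A B \<and> f ` S \<subseteq> T"
proof -
  interpret A: right_normal_pair A S by fact
  interpret B: right_normal_pair B T by fact
  have "f ` S \<subseteq> T" if f: "f \<in> monoid_hom A B"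
    and mono: "\<forall>(a, b) \<in> leq_of A S. (f a, f b) \<in> leq_of B T"
  proof
    fix y assume "y \<in> f ` S"
    then obtain x where x: "x \<in> S" "y = f x" by blast
    then have "(\<one>\<^bsub>A\<^esub>, x) \<in> leq_of A S" by (auto simp: A.leq_of_iff)
    with mono have "(f \<one>\<^bsub>A\<^esub>, f x) \<in> leq_of B T" by blast
    then show "y \<in> T" using f x by (auto simp: B.leq_of_iff monoid_hom_def)
  qed
  moreover have "(f a, f b) \<in> leq_of B T"
    if "f \<in> monoid_hom A B" "f ` S \<subseteq> T" "(a, b) \<in> leq_of A S" for a b
  proof -
    obtain x where x: "a \<in> carrier A" "x \<in> S" "b = x \<otimes>\<^bsub>A\<^esub> a"
      using \<open>(a, b) \<in> leq_of A S\<close> by (auto simp: A.leq_of_iff)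
    then have "f b = f x \<otimes>\<^bsub>B\<^esub> f a" "f a \<in> carrier B" "f x \<in> T"
      using \<open>f \<in> monoid_hom A B\<close> \<open>f ` S \<subseteq> T\<close> by (auto simp: monoid_hom_def hom_def)
    then show ?thesis by (auto simp: B.leq_of_iff)
  qed
  ultimately show ?thesis
    by (auto simp: monotone_hom_def)
qed

section \<open>Common description of the two categories\<close>

text \<open>An object is rebuilt from its underlying monoid and its cone, which serve as
  \<open>A\<close> and \<open>S\<close>. Conversely, the order built from \<open>S\<close> has cone
  \<open>S\<close> and hence coincides with the order of its cone.\<close>

lemma Ob_OrdMon_star:
  "Ob OrdMon_star = {cone_preordered A S | A S. right_normal_pair A S}"
proof (intro equalityI subsetI)
  fix X :: "'a preordered_monoid"
  assume "X \<in> Ob OrdMon_star"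
  then have "preordered_monoid X" "leq X = leq_of X (positive_cone X)"
    by (auto simp: OrdMon_star_def OrdMon_def full_subcategory_def concrete_category_def)
  then show "X \<in> {cone_preordered A S | A S. right_normal_pair A S}"
    by (metis (mono_tags, lifting) mem_Collect_eq cone_preordered_positive_cone
        right_normal_pair_positive_cone)
next
  fix X :: "'a preordered_monoid"
  assume "X \<in> {cone_preordered A S | A S. right_normal_pair A S}"
  then show "X \<in> Ob OrdMon_star"
    by (auto simp: OrdMon_star_def OrdMon_def full_subcategory_def concrete_category_def
        right_normal_pair.preordered_monoid_cone_preordered
        right_normal_pair.positive_cone_cone_preordered)
qed

lemma Mor_OrdMon_star:
  "Mor OrdMon_star = {Arr (cone_preordered A S) f (cone_preordered B T) | A S f B T.
     right_normal_pair A S \<and> right_normal_pair B T \<and> f \<in> monoid_hom A B \<and> f ` S \<subseteq> T}"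
proof -
  have "Mor OrdMon_star =
      {Arr X f Y | X f Y. X \<in> Ob OrdMon_star \<and> Y \<in> Ob OrdMon_star \<and> f \<in> monotone_hom X Y}"
    by (auto simp: OrdMon_star_def OrdMon_def full_subcategory_def concrete_category_def)
  also have "\<dots> = {Arr (cone_preordered A S) f (cone_preordered B T) | A S f B T.
     right_normal_pair A S \<and> right_normal_pair B T \<and> f \<in> monoid_hom A B \<and> f ` S \<subseteq> T}"
    unfolding Ob_OrdMon_star by (auto simp: monotone_hom_cone_preordered) metis+
  finally show ?thesis .
qed

section \<open>Commutative squares between inclusions of submonoids\<close>

definition inclusion_square ::
    "'a monoid \<Rightarrow> 'a set \<Rightarrow> ('a \<Rightarrow> 'a) \<Rightarrow> 'a monoid \<Rightarrow> 'a set \<Rightarrow>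
      (('a monoid, 'a \<Rightarrow> 'a) arr,
       ('a monoid, 'a \<Rightarrow> 'a) arr \<times> ('a monoid, 'a \<Rightarrow> 'a) arr) arr" where
  "inclusion_square A S f B T =
     Arr (submonoid_inclusion A S)
       (Arr (submonoid_structure A S) (restrict f S) (submonoid_structure B T), Arr A f B)
       (submonoid_inclusion B T)"

lemma carrier_submonoid_structure [simp]: "carrier (submonoid_structure A S) = S"
  by (simp add: submonoid_structure_def)

lemma submonoid_inclusion_sel [simp]:
  "src (submonoid_inclusion A S) = submonoid_structure A S"
  "the_map (submonoid_inclusion A S) = (\<lambda>x\<in>S. x)"
  "tgt (submonoid_inclusion A S) = A"
  by (simp_all add: submonoid_inclusion_def)

text \<open>The monoid is recovered as the target of the inclusion, the submonoid as the carrier of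
  its source.\<close>

lemma submonoid_inclusion_eq_iff [simp]:
  "submonoid_inclusion A S = submonoid_inclusion B T \<longleftrightarrow> A = B \<and> S = T"
  by (metis submonoid_inclusion_sel(1,3) carrier_submonoid_structure)

lemma inclusion_square_sel [simp]:
  "src (inclusion_square A S f B T) = submonoid_inclusion A S"
  "tgt (inclusion_square A S f B T) = submonoid_inclusion B T"
  by (simp_all add: inclusion_square_def)

lemma Mor_Mon_iff:
  "Arr A f B \<in> Mor Mon \<longleftrightarrow> canonical_monoid A \<and> canonical_monoid B \<and> f \<in> monoid_hom A B"
  by (auto simp: Mon_def concrete_category_def)

lemma Mon_sel [simp]:
  "Dom Mon = src" "Cod Mon = tgt"
  "Id Mon A = Arr A (\<lambda>x\<in>carrier A. x) A"
  "Comp Mon g f = Arr (src f) (compose (carrier (src f)) (the_map g) (the_map f)) (tgt g)"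
  by (simp_all add: Mon_def concrete_category_def)

lemma submonoid_inclusion_in_Mor_Mon:
  assumes "right_normal_pair A S"
  shows "submonoid_inclusion A S \<in> Mor Mon"
proof -
  interpret right_normal_pair A S by fact
  have "(\<lambda>x\<in>S. x) \<in> monoid_hom (submonoid_structure A S) A"
    by (auto simp: monoid_hom_def hom_def submonoid_structure_def)
  then show ?thesis
    using canonical_monoid_axioms canonical_monoid_submonoid_structure
    by (simp add: submonoid_inclusion_def Mor_Mon_iff)
qed

text \<open>Inclusions are injective and hence left cancellable; this discharges the monomorphism
  clause of \<open>right_normal_mono\<close>.\<close>

lemma monomorphism_submonoid_inclusion:
  assumes "right_normal_pair A S"
  shows "monomorphism Mon (submonoid_inclusion A S)"
  unfolding monomorphism_def
proof (intro conjI ballI impI submonoid_inclusion_in_Mor_Mon[OF assms])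
  fix f g :: "('a monoid, 'a \<Rightarrow> 'a) arr"
  let ?m = "submonoid_inclusion A S"
  assume fg: "f \<in> Mor Mon" "g \<in> Mor Mon"
    and eq: "Dom Mon f = Dom Mon g \<and> Cod Mon f = Dom Mon ?m \<and> Cod Mon g = Dom Mon ?m \<and>
      Comp Mon ?m f = Comp Mon ?m g"
  obtain X f' where f: "f = Arr X f' (submonoid_structure A S)"
    using eq by (cases f) auto
  obtain g' where g: "g = Arr X g' (submonoid_structure A S)"
    using eq f by (cases g) auto
  have f': "f' \<in> carrier X \<rightarrow>\<^sub>E S" and g': "g' \<in> carrier X \<rightarrow>\<^sub>E S"
    using fg monoid_hom_PiE[of f' X "submonoid_structure A S"]
      monoid_hom_PiE[of g' X "submonoid_structure A S"]
    by (simp_all add: f g Mor_Mon_iff)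
  have eq': "compose (carrier X) (\<lambda>x\<in>S. x) f' = compose (carrier X) (\<lambda>x\<in>S. x) g'"
    using eq by (simp add: f g)
  have "f' = g'"
  \<comment> \<open>Both maps take values in \<open>S\<close>, where the restricted inclusion is the
    identity, so the equal composites can be compared at each point.\<close>
  proof (rule PiE_ext[OF f' g'])
    fix x assume "x \<in> carrier X"
    then show "f' x = g' x"
      using fun_cong[OF eq', of x] PiE_mem[OF f'] PiE_mem[OF g'] by (simp add: compose_def)
  qed
  then show "f = g" by (simp add: f g)
qed

text \<open>The image of the inclusion of \<open>S\<close> is \<open>S\<close> itself, so right
  normality of the image is right normality of \<open>S\<close>.\<close>

lemma Ob_RNMono_Mon:
  "Ob RNMono_Mon = {submonoid_inclusion A S | A S. right_normal_pair A S}"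
  by (auto simp: RNMono_Mon_def full_subcategory_def arrow_category_def right_normal_mono_def
      right_normal_pair_def submonoid_inclusion_in_Mor_Mon monomorphism_submonoid_inclusion
      right_normal_submonoid_def)

lemma inclusion_square_in_Mor:
  assumes "right_normal_pair A S" "right_normal_pair B T" "f \<in> monoid_hom A B" "f ` S \<subseteq> T"
  shows "inclusion_square A S f B T \<in> Mor (arrow_category Mon)"
proof -
  interpret A: right_normal_pair A S by fact
  interpret B: right_normal_pair B T by fact
  have "restrict f S \<in> monoid_hom (submonoid_structure A S) (submonoid_structure B T)"
    using assms(3,4) by (auto simp: monoid_hom_def hom_def submonoid_structure_def)
  \<comment> \<open>Both ways around the square are \<open>f\<close> on \<open>S\<close>, since
    \<open>f\<close> already maps \<open>S\<close> into \<open>T\<close>.\<close>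
  moreover have "compose S (\<lambda>x\<in>T. x) (restrict f S) = compose S f (\<lambda>x\<in>S. x)"
    using assms(4) by (auto simp: compose_def fun_eq_iff)
  ultimately show ?thesis
    using assms A.canonical_monoid_submonoid_structure B.canonical_monoid_submonoid_structure
      A.canonical_monoid_axioms B.canonical_monoid_axioms
    by (simp add: arrow_category_def inclusion_square_def submonoid_inclusion_in_Mor_Mon Mor_Mon_iff)
qed

lemma inclusion_square_cases:
  assumes "Arr (submonoid_inclusion A S) (u, v) (submonoid_inclusion B T)
      \<in> Mor (arrow_category Mon)"
  obtains f where "f \<in> monoid_hom A B" "f ` S \<subseteq> T"
    "Arr (submonoid_inclusion A S) (u, v) (submonoid_inclusion B T) = inclusion_square A S f B T"
proof -
  from assms have uv: "u \<in> Mor Mon" "v \<in> Mor Mon" "src u = submonoid_structure A S"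
      "tgt u = submonoid_structure B T" "src v = A" "tgt v = B"
      "Comp Mon (submonoid_inclusion B T) u = Comp Mon v (submonoid_inclusion A S)"
    unfolding Arr_in_Mor_arrow_category Mon_sel(1,2) submonoid_inclusion_sel by blast+
  define f where "f = the_map v"
  define g where "g = the_map u"
  have u: "u = Arr (submonoid_structure A S) g (submonoid_structure B T)" and v: "v = Arr A f B"
    using uv(3-6) unfolding f_def g_def by (metis arr.collapse)+
  have g: "g \<in> S \<rightarrow>\<^sub>E T" and f: "f \<in> monoid_hom A B"
    using uv(1,2) monoid_hom_PiE[of g "submonoid_structure A S" "submonoid_structure B T"]
    by (simp_all add: u v Mor_Mon_iff)
  have eq: "compose S (\<lambda>x\<in>T. x) g = compose S f (\<lambda>x\<in>S. x)"
    using uv(7) by (simp add: u v)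
  have fg: "f x = g x" if "x \<in> S" for x
    using fun_cong[OF eq, of x] that PiE_mem[OF g that] by (simp add: compose_def)
  \<comment> \<open>Agreement on \<open>S\<close> becomes equality of functions because
    \<open>g\<close> is \<open>undefined\<close> off \<open>S\<close>.\<close>
  have "g = restrict f S"
    using g fg by (auto simp: PiE_def extensional_def fun_eq_iff)
  moreover have "f ` S \<subseteq> T"
    using fg PiE_mem[OF g] by auto
  ultimately show thesis
    using f that by (simp add: u v inclusion_square_def)
qed

lemma Mor_RNMono_Mon:
  "Mor RNMono_Mon = {inclusion_square A S f B T | A S f B T.
     right_normal_pair A S \<and> right_normal_pair B T \<and> f \<in> monoid_hom A B \<and> f ` S \<subseteq> T}"
proof -
  have Mor: "q \<in> Mor RNMono_Mon \<longleftrightarrow>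
      q \<in> Mor (arrow_category Mon) \<and> src q \<in> Ob RNMono_Mon \<and> tgt q \<in> Ob RNMono_Mon" for q
    by (auto simp: RNMono_Mon_def full_subcategory_def arrow_category_def)
  show ?thesis
  proof (intro equalityI subsetI)
    fix q :: "(('a monoid, 'a \<Rightarrow> 'a) arr,
      ('a monoid, 'a \<Rightarrow> 'a) arr \<times> ('a monoid, 'a \<Rightarrow> 'a) arr) arr"
    assume q: "q \<in> Mor RNMono_Mon"
    then obtain A S B T u v where *: "right_normal_pair A S" "right_normal_pair B T"
        "q = Arr (submonoid_inclusion A S) (u, v) (submonoid_inclusion B T)"
      by (cases q) (auto simp: Mor Ob_RNMono_Mon)
    then obtain f where "f \<in> monoid_hom A B" "f ` S \<subseteq> T" "q = inclusion_square A S f B T"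
      using q by (auto simp: Mor elim: inclusion_square_cases)
    then show "q \<in> {inclusion_square A S f B T | A S f B T.
        right_normal_pair A S \<and> right_normal_pair B T \<and> f \<in> monoid_hom A B \<and> f ` S \<subseteq> T}"
      using * by blast
  next
    fix q :: "(('a monoid, 'a \<Rightarrow> 'a) arr,
      ('a monoid, 'a \<Rightarrow> 'a) arr \<times> ('a monoid, 'a \<Rightarrow> 'a) arr) arr"
    assume "q \<in> {inclusion_square A S f B T | A S f B T.
        right_normal_pair A S \<and> right_normal_pair B T \<and> f \<in> monoid_hom A B \<and> f ` S \<subseteq> T}"
    then obtain A S f B T where *: "right_normal_pair A S" "right_normal_pair B T"
        "f \<in> monoid_hom A B" "f ` S \<subseteq> T" "q = inclusion_square A S f B T"
      by blast
    then show "q \<in> Mor RNMono_Mon"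
      using inclusion_square_in_Mor[OF *(1-4)] by (auto simp: Mor Ob_RNMono_Mon)
  qed
qed

section \<open>Category axioms and structure maps of the two categories\<close>

lemma category_OrdMon_star: "category OrdMon_star"
  unfolding OrdMon_star_def by (intro category_full_subcategory category_OrdMon)

lemma category_RNMono_Mon: "category RNMono_Mon"
  unfolding RNMono_Mon_def
  by (intro category_full_subcategory category_arrow_category category_Mon)

lemma OrdMon_star_sel [simp]:
  "Dom OrdMon_star = src" "Cod OrdMon_star = tgt"
  "Id OrdMon_star A = Arr A (\<lambda>x\<in>carrier A. x) A"
  "Comp OrdMon_star g f = Arr (src f) (compose (carrier (src f)) (the_map g) (the_map f)) (tgt g)"
  by (simp_all add: OrdMon_star_def OrdMon_def full_subcategory_def concrete_category_def)

lemma RNMono_Mon_sel [simp]: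
  "Dom RNMono_Mon = src" "Cod RNMono_Mon = tgt"
  "Id RNMono_Mon m = Arr m (Id Mon (src m), Id Mon (tgt m)) m"
  "Comp RNMono_Mon q p = Arr (src p)
    (Comp Mon (fst (the_map q)) (fst (the_map p)), Comp Mon (snd (the_map q)) (snd (the_map p)))
    (tgt q)"
  by (simp_all add: RNMono_Mon_def full_subcategory_def arrow_category_def)

section \<open>The mutually inverse functors\<close>

definition cone_ob :: "'a preordered_monoid \<Rightarrow> ('a monoid, 'a \<Rightarrow> 'a) arr" where
  "cone_ob X = submonoid_inclusion (underlying_monoid X) (positive_cone X)"

definition cone_mor where
  "cone_mor p = inclusion_square (underlying_monoid (src p)) (positive_cone (src p)) (the_map p)
     (underlying_monoid (tgt p)) (positive_cone (tgt p))"

definition order_ob :: "('a monoid, 'a \<Rightarrow> 'a) arr \<Rightarrow> 'a preordered_monoid" where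
  "order_ob m = cone_preordered (tgt m) (carrier (src m))"

text \<open>The second component is the homomorphism of ambient monoids; the first is its
  restriction, so forgetting it loses nothing.\<close>

definition order_mor where
  "order_mor q = Arr (order_ob (src q)) (the_map (snd (the_map q))) (order_ob (tgt q))"

lemma cone_ob_cone_preordered:
  "right_normal_pair A S \<Longrightarrow> cone_ob (cone_preordered A S) = submonoid_inclusion A S"
  by (simp add: cone_ob_def right_normal_pair.positive_cone_cone_preordered)

lemma cone_mor_Arr:
  "\<lbrakk>right_normal_pair A S; right_normal_pair B T\<rbrakk> \<Longrightarrow>
    cone_mor (Arr (cone_preordered A S) f (cone_preordered B T)) = inclusion_square A S f B T"
  by (simp add: cone_mor_def right_normal_pair.positive_cone_cone_preordered)

lemma order_ob_submonoid_inclusion [simp]: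
  "order_ob (submonoid_inclusion A S) = cone_preordered A S"
  by (simp add: order_ob_def)

lemma order_mor_inclusion_square [simp]:
  "order_mor (inclusion_square A S f B T) = Arr (cone_preordered A S) f (cone_preordered B T)"
  by (simp add: order_mor_def inclusion_square_def)

text \<open>Restriction commutes with composition because \<open>f\<close> maps \<open>S\<close>
  into \<open>T\<close>, where the restricted \<open>g\<close> agrees with \<open>g\<close>.\<close>

lemma Comp_inclusion_square:
  assumes "right_normal_pair A S" "f ` S \<subseteq> T"
  shows "Comp RNMono_Mon (inclusion_square B T g C U) (inclusion_square A S f B T) =
    inclusion_square A S (compose (carrier A) g f) C U"
proof -
  interpret right_normal_pair A S by fact
  have "compose S (restrict g T) (restrict f S) = restrict (compose (carrier A) g f) S"
    using assms(2) subset by (auto simp: compose_def fun_eq_iff)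
  then show ?thesis by (simp add: inclusion_square_def)
qed

lemma Id_submonoid_inclusion:
  assumes "right_normal_pair A S"
  shows "Id RNMono_Mon (submonoid_inclusion A S) =
    inclusion_square A S (\<lambda>x\<in>carrier A. x) A S"
proof -
  interpret right_normal_pair A S by fact
  have "(\<lambda>x\<in>S. x) = restrict (\<lambda>x\<in>carrier A. x) S" by auto
  then show ?thesis by (simp add: inclusion_square_def)
qed

lemma cone_functor: "cat_functor OrdMon_star RNMono_Mon cone_ob cone_mor"
proof (intro cat_functor.intro category_OrdMon_star category_RNMono_Mon cat_functor_axioms.intro)
  fix X :: "'a preordered_monoid"
  assume "X \<in> Ob OrdMon_star"
  then obtain A S where X: "right_normal_pair A S" "X = cone_preordered A S"
    by (auto simp: Ob_OrdMon_star)
  then show "cone_ob X \<in> Ob RNMono_Mon"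
    by (auto simp: Ob_RNMono_Mon cone_ob_cone_preordered)
  from X show "cone_mor (Id OrdMon_star X) = Id RNMono_Mon (cone_ob X)"
    by (simp add: cone_mor_Arr cone_ob_cone_preordered Id_submonoid_inclusion
        del: RNMono_Mon_sel(3))
next
  fix p :: "('a preordered_monoid, 'a \<Rightarrow> 'a) arr"
  assume "p \<in> Mor OrdMon_star"
  then obtain A S f B T where p: "right_normal_pair A S" "right_normal_pair B T"
      "f \<in> monoid_hom A B" "f ` S \<subseteq> T" "p = Arr (cone_preordered A S) f (cone_preordered B T)"
    unfolding Mor_OrdMon_star by blast
  then have cone_p: "cone_mor p = inclusion_square A S f B T"
    by (simp add: cone_mor_Arr)
  show "cone_mor p \<in> Mor RNMono_Mon"
    unfolding cone_p Mor_RNMono_Mon using p by blast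
  show "Dom RNMono_Mon (cone_mor p) = cone_ob (Dom OrdMon_star p)"
    "Cod RNMono_Mon (cone_mor p) = cone_ob (Cod OrdMon_star p)"
    using p by (simp_all add: cone_mor_Arr cone_ob_cone_preordered)
  fix q :: "('a preordered_monoid, 'a \<Rightarrow> 'a) arr"
  assume "q \<in> Mor OrdMon_star" and "Cod OrdMon_star p = Dom OrdMon_star q"
  \<comment> \<open>Composability allows the source of \<open>q\<close> to be written with the same
    \<open>B\<close> and \<open>T\<close> as the target of \<open>p\<close>.\<close>
  then obtain g C U where q: "right_normal_pair C U"
      "q = Arr (cone_preordered B T) g (cone_preordered C U)"
    using p(2,5) unfolding Mor_OrdMon_star by auto
  show "cone_mor (Comp OrdMon_star q p) = Comp RNMono_Mon (cone_mor q) (cone_mor p)"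
    using p q by (simp add: cone_mor_Arr Comp_inclusion_square del: RNMono_Mon_sel(4))
qed

lemma order_functor: "cat_functor RNMono_Mon OrdMon_star order_ob order_mor"
proof (intro cat_functor.intro category_OrdMon_star category_RNMono_Mon cat_functor_axioms.intro)
  fix m :: "('a monoid, 'a \<Rightarrow> 'a) arr"
  assume "m \<in> Ob RNMono_Mon"
  then obtain A S where m: "right_normal_pair A S" "m = submonoid_inclusion A S"
    by (auto simp: Ob_RNMono_Mon)
  then show "order_ob m \<in> Ob OrdMon_star"
    by (auto simp: Ob_OrdMon_star)
  from m show "order_mor (Id RNMono_Mon m) = Id OrdMon_star (order_ob m)"
    by (simp add: Id_submonoid_inclusion del: RNMono_Mon_sel(3))
next
  fix p :: "(('a monoid, 'a \<Rightarrow> 'a) arr,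
      ('a monoid, 'a \<Rightarrow> 'a) arr \<times> ('a monoid, 'a \<Rightarrow> 'a) arr) arr"
  assume "p \<in> Mor RNMono_Mon"
  then obtain A S f B T where p: "right_normal_pair A S" "right_normal_pair B T"
      "f \<in> monoid_hom A B" "f ` S \<subseteq> T" "p = inclusion_square A S f B T"
    unfolding Mor_RNMono_Mon by blast
  then have order_p: "order_mor p = Arr (cone_preordered A S) f (cone_preordered B T)"
    by simp
  show "order_mor p \<in> Mor OrdMon_star"
    unfolding order_p Mor_OrdMon_star using p by blast
  show "Dom OrdMon_star (order_mor p) = order_ob (Dom RNMono_Mon p)"
    "Cod OrdMon_star (order_mor p) = order_ob (Cod RNMono_Mon p)"
    by (simp_all add: p(5))
  fix q :: "(('a monoid, 'a \<Rightarrow> 'a) arr,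
      ('a monoid, 'a \<Rightarrow> 'a) arr \<times> ('a monoid, 'a \<Rightarrow> 'a) arr) arr"
  assume "q \<in> Mor RNMono_Mon" and "Cod RNMono_Mon p = Dom RNMono_Mon q"
  then obtain g C U where q: "q = inclusion_square B T g C U"
    using p(5) unfolding Mor_RNMono_Mon by auto
  show "order_mor (Comp RNMono_Mon q p) = Comp OrdMon_star (order_mor q) (order_mor p)"
    using p q by (simp add: Comp_inclusion_square del: RNMono_Mon_sel(4))
qed

theorem theorem1:
  shows "isomorphic_categories
           (OrdMon_star ::
              ('a preordered_monoid, ('a preordered_monoid, 'a \<Rightarrow> 'a) arr) category)
           (RNMono_Mon ::
              (('a monoid, 'a \<Rightarrow> 'a) arr,
               (('a monoid, 'a \<Rightarrow> 'a) arr,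
                ('a monoid, 'a \<Rightarrow> 'a) arr \<times> ('a monoid, 'a \<Rightarrow> 'a) arr) arr) category)"
  unfolding isomorphic_categories_def
proof (intro exI conjI)
  show "cat_functor OrdMon_star RNMono_Mon cone_ob cone_mor" by (rule cone_functor)
  show "cat_functor RNMono_Mon OrdMon_star order_ob order_mor" by (rule order_functor)
\<comment> \<open>The four inverse laws are checked on the normal forms: both functors only exchange
  \<open>cone_preordered A S\<close> with \<open>submonoid_inclusion A S\<close>, and the arrow
  given by \<open>f\<close> with \<open>inclusion_square A S f B T\<close>.\<close>
qed (auto simp: Ob_OrdMon_star Ob_RNMono_Mon Mor_OrdMon_star Mor_RNMono_Mon cone_ob_cone_preordered
    cone_mor_Arr)

end
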